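(* Let $n\ge 3$, $n\ne 4$, and let $C_n$ be the cycle on $n$ vertices (without loops). Then $\mathrm{st}_+(C_n)=n$. Furthermore, $\mathrm{st}_+(C_4)=2$.
   Context: $\mathcal S_n^+$ is the set of symmetric entrywise nonnegative real $n\times n$ matrices. For $A\in\mathcal S_n^+$, $\mathrm{st}_+(A)$ is the minimal $k\ge 0$ such that $A=BCB^T$ with $B$ an entrywise nonnegative real $n\times k$ matrix and $C\in\mathcal S_k^+$. The pattern graph $G(A)$ of $A$ has vertex set $[n]=\{1,\dots,n\}$ and $\{i,j\}\in E(G(A))$ iff $a_{ij}>0$ (a loop $\{i\}$ is present iff $a_{ii}>0$). For a finite undirected graph $G$ (loops allowed) with $n$ vertices (identified with $[n]$), $\mathcal S^+(G)=\{A\in\mathcal S_n^+: G(A)=G\}$ and $\mathrm{st}_+(G)=\min\{\mathrm{st}_+(A): A\in\mathcal S^+(G)\}$. In particular, for a graph without loops the matrices in $\mathcal S^+(G)$ have zero diagonal. *)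

theory Defs
  imports "Jordan_Normal_Form.Matrix"
begin

text \<open>
  Matrices and graph vertices are indexed from 0, following the matrix library: the vertex set
  \<open>[n] = {1, \<dots>, n}\<close> becomes \<open>{..<n}\<close>.
\<close>

definition nonneg_mat :: "real mat \<Rightarrow> bool" where
  "nonneg_mat A \<longleftrightarrow> (\<forall>i < dim_row A. \<forall>j < dim_col A. 0 \<le> A $$ (i, j))"

definition sym_nonneg_mats :: "nat \<Rightarrow> real mat set" where
  "sym_nonneg_mats n = {A \<in> carrier_mat n n. transpose_mat A = A \<and> nonneg_mat A}"

definition has_snt_factorization :: "real mat \<Rightarrow> nat \<Rightarrow> bool" where
  "has_snt_factorization A k \<longleftrightarrow>
    (\<exists>B C. B \<in> carrier_mat (dim_row A) k \<and> nonneg_mat B \<and> C \<in> sym_nonneg_mats k \<and>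
           A = B * C * transpose_mat B)"

definition st_plus :: "real mat \<Rightarrow> nat" where
  "st_plus A = (LEAST k. has_snt_factorization A k)"

text \<open>
  An undirected graph, loops allowed, is a pair of a vertex set and an edge set; an edge is an
  unordered pair \<open>{i, j}\<close> and a loop is a singleton \<open>{i}\<close>.
\<close>

type_synonym ugraph = "nat set \<times> nat set set"

definition pattern_graph :: "real mat \<Rightarrow> ugraph" where
  "pattern_graph A =
    ({..<dim_row A}, {{i, j} | i j. i < dim_row A \<and> j < dim_row A \<and> A $$ (i, j) > 0})"

definition pattern_mats :: "ugraph \<Rightarrow> real mat set" where
  "pattern_mats G = {A \<in> sym_nonneg_mats (card (fst G)). pattern_graph A = G}"

definition st_plus_graph :: "ugraph \<Rightarrow> nat" where
  "st_plus_graph G = (LEAST k. \<exists>A \<in> pattern_mats G. st_plus A = k)"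

text \<open>A cycle, with no loops, only for \<open>n \<ge> 3\<close>.\<close>

definition cycle_graph :: "nat \<Rightarrow> ugraph" where
  "cycle_graph n = ({..<n}, {{i, Suc i mod n} | i. i < n})"

text \<open>Both minima range over nonempty sets, so the \<open>LEAST\<close> operators denote attained minima.\<close>

lemma has_snt_factorization_dim:
  assumes "A \<in> sym_nonneg_mats n"
  shows "has_snt_factorization A n"
proof -
  have A: "A \<in> carrier_mat n n" using assms by (simp add: sym_nonneg_mats_def)
  have "A = 1\<^sub>m n * A * transpose_mat (1\<^sub>m n)" using A by simp
  moreover have "nonneg_mat (1\<^sub>m n)" by (simp add: nonneg_mat_def)
  ultimately show ?thesis
    unfolding has_snt_factorization_def using A assms
    by (intro exI[of _ "1\<^sub>m n"] exI[of _ A]) simp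
qed

lemma st_plus_attained:
  assumes "A \<in> sym_nonneg_mats n"
  shows "has_snt_factorization A (st_plus A)"
  unfolding st_plus_def using has_snt_factorization_dim[OF assms] by (rule LeastI)

lemma pattern_mats_nonempty:
  assumes E: "\<And>e. e \<in> E \<Longrightarrow> \<exists>i j. e = {i, j} \<and> i < n \<and> j < n"
  shows "pattern_mats ({..<n}, E) \<noteq> {}"
proof -
  define A :: "real mat" where "A = mat n n (\<lambda>(i, j). if {i, j} \<in> E then 1 else 0)"
  have "transpose_mat A = A"
    by (rule eq_matI) (simp_all add: A_def insert_commute)
  then have "A \<in> sym_nonneg_mats n"
    by (simp add: A_def sym_nonneg_mats_def nonneg_mat_def)
  moreover have "pattern_graph A = ({..<n}, E)"
  proof -
    have entry: "A $$ (i, j) > 0 \<longleftrightarrow> {i, j} \<in> E" if "i < n" "j < n" for i j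
      using that by (simp add: A_def)
    have "{{i, j} | i j. i < n \<and> j < n \<and> A $$ (i, j) > 0} = E" (is "?L = E")
    proof (rule Set.equalityI; rule Set.subsetI)
      fix e assume "e \<in> ?L"
      then obtain i j where "e = {i, j}" "i < n" "j < n" "A $$ (i, j) > 0" by blast
      then show "e \<in> E" using entry by simp
    next
      fix e assume e: "e \<in> E"
      obtain i j where ij: "e = {i, j}" "i < n" "j < n" using E[OF e] by (elim exE conjE)
      with e entry have "A $$ (i, j) > 0" by simp
      with ij show "e \<in> ?L" by (intro CollectI exI conjI)
    qed
    moreover have "dim_row A = n" by (simp add: A_def)
    ultimately show ?thesis by (simp add: pattern_graph_def)
  qed
  ultimately have "A \<in> pattern_mats ({..<n}, E)" by (simp add: pattern_mats_def)
  then show ?thesis by blast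
qed

lemma st_plus_graph_attained:
  assumes "pattern_mats G \<noteq> {}"
  shows "\<exists>A \<in> pattern_mats G. st_plus A = st_plus_graph G"
proof -
  have "\<exists>k. \<exists>A \<in> pattern_mats G. st_plus A = k" using assms by blast
  then show ?thesis unfolding st_plus_graph_def by (rule LeastI_ex)
qed

lemma pattern_mats_cycle_graph_nonempty:
  "pattern_mats (cycle_graph n) \<noteq> {}"
  unfolding cycle_graph_def
proof (rule pattern_mats_nonempty)
  fix e assume "e \<in> {{i, Suc i mod n} | i. i < n}"
  then obtain i where "e = {i, Suc i mod n}" "i < n" by blast
  moreover have "Suc i mod n < n" using \<open>i < n\<close> by simp
  ultimately show "\<exists>i j. e = {i, j} \<and> i < n \<and> j < n" by blast
qed

end

theory Submission
  imports Defs
begin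

text \<open>
  The lower bounds rest on a fooling set argument. Suppose \<open>A = B D\<close> with nonnegative factors of
  inner dimension \<open>k\<close>. A positive entry of \<open>A\<close> at \<open>(i, j)\<close> needs an inner index \<open>p\<close> with
  \<open>B\<^sub>i\<^sub>p > 0\<close> and \<open>D\<^sub>p\<^sub>j > 0\<close>. If one \<open>p\<close> serves two positive entries \<open>(i, j)\<close> and
  \<open>(i', j')\<close>, then the crossed entries \<open>(i, j')\<close> and \<open>(i', j)\<close> are positive too. So a family of
  positive entries, each two of which have a crossed entry equal to zero, has at most \<open>k\<close> members.
  A symmetric factorization \<open>B C B\<^sup>T\<close> is such a product with \<open>D = C B\<^sup>T\<close>.

  For the cycle take the \<open>n\<close> entries \<open>(i, i + 1)\<close>, with indices modulo \<open>n\<close>. For \<open>i \<noteq> j\<close>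
  both crossed entries \<open>(i, j + 1)\<close> and \<open>(j, i + 1)\<close> are positive only if \<open>i = j + 2\<close> and
  \<open>j = i + 2\<close>, hence only if \<open>n\<close> divides 4. This gives the lower bound \<open>n\<close> whenever \<open>n \<ge> 3\<close> and
  \<open>n \<noteq> 4\<close>; the trivial factorization with \<open>B = I\<close> attains it.

  The 4-cycle is the complete bipartite graph between the even and the odd vertices, so its
  adjacency matrix factors through the two parity classes. The entries \<open>(0, 1)\<close> and \<open>(1, 0)\<close>
  show that one class would not do, since the diagonal vanishes.
\<close>

text \<open>Sending each chosen entry \<open>(i, s i)\<close> to an inner index that makes it positive is injective: two
  entries with a common inner index have both crossed entries positive.\<close>

lemma fooling_set_bound:
  assumes A: "A \<in> carrier_mat n n"
    and fac: "has_snt_factorization A k"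
    and I: "I \<subseteq> {..<n}" "s ` I \<subseteq> {..<n}"
    and pos: "\<And>i. i \<in> I \<Longrightarrow> 0 < A $$ (i, s i)"
    and crossed: "\<And>i j. i \<in> I \<Longrightarrow> j \<in> I \<Longrightarrow> 0 < A $$ (i, s j) \<Longrightarrow> 0 < A $$ (j, s i) \<Longrightarrow> i = j"
  shows "card I \<le> k"
proof -
  obtain B C where B: "B \<in> carrier_mat n k" and B0: "nonneg_mat B"
    and C: "C \<in> carrier_mat k k" and C0: "nonneg_mat C" and fact: "A = B * C * transpose_mat B"
    using fac A unfolding has_snt_factorization_def sym_nonneg_mats_def by auto
  define D where "D = C * transpose_mat B"
  have D: "D \<in> carrier_mat k n" using B C by (simp add: D_def)
  have AD: "A = B * D" using fact B C by (simp add: D_def)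
  have B_nonneg: "0 \<le> B $$ (i, p)" if "i < n" "p < k" for i p
    using B0 B that by (auto simp: nonneg_mat_def)
  have D_nonneg: "0 \<le> D $$ (p, j)" if "p < k" "j < n" for p j
  proof -
    have "D $$ (p, j) = (\<Sum>q<k. C $$ (p, q) * B $$ (j, q))"
      using that B C by (simp add: D_def scalar_prod_def lessThan_atLeast0)
    also have "\<dots> \<ge> 0"
      using that C0 C B_nonneg by (intro sum_nonneg mult_nonneg_nonneg) (auto simp: nonneg_mat_def)
    finally show ?thesis .
  qed
  have entry: "A $$ (i, j) = (\<Sum>p<k. B $$ (i, p) * D $$ (p, j))" if "i < n" "j < n" for i j
    using that B D by (simp add: AD scalar_prod_def lessThan_atLeast0)
  have positive_iff: "0 < A $$ (i, j) \<longleftrightarrow> (\<exists>p<k. 0 < B $$ (i, p) \<and> 0 < D $$ (p, j))"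
    if ij: "i < n" "j < n" for i j
  proof -
    have terms: "0 \<le> B $$ (i, p) * D $$ (p, j)" if "p \<in> {..<k}" for p
      using that ij B_nonneg D_nonneg by simp
    have "0 < A $$ (i, j) \<longleftrightarrow> (\<Sum>p<k. B $$ (i, p) * D $$ (p, j)) \<noteq> 0"
      using sum_nonneg[of "{..<k}", OF terms] unfolding entry[OF ij] by (auto simp: less_le)
    also have "\<dots> \<longleftrightarrow> (\<exists>p<k. B $$ (i, p) * D $$ (p, j) \<noteq> 0)"
      using sum_nonneg_eq_0_iff[of "{..<k}", OF _ terms] by auto
    also have "\<dots> \<longleftrightarrow> (\<exists>p<k. 0 < B $$ (i, p) \<and> 0 < D $$ (p, j))"
      using ij B_nonneg D_nonneg by (auto simp: less_le)
    finally show ?thesis .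
  qed
  have less_n: "i < n" "s i < n" if "i \<in> I" for i
    using that I by auto
  have "\<exists>p<k. 0 < B $$ (i, p) \<and> 0 < D $$ (p, s i)" if "i \<in> I" for i
    using pos[OF that] positive_iff[OF less_n[OF that]] by simp
  then obtain f where f: "f i < k" "0 < B $$ (i, f i)" "0 < D $$ (f i, s i)" if "i \<in> I" for i
    by metis
  have "inj_on f I"
  proof (rule inj_onI)
    fix i j assume "i \<in> I" "j \<in> I" "f i = f j"
    then show "i = j"
      using crossed[of i j] positive_iff[of i "s j"] positive_iff[of j "s i"] less_n f by metis
  qed
  then show ?thesis
    using card_inj_on_le[of f I "{..<k}"] f(1) by auto
qed

lemma st_plus_graph_eqI:
  assumes attained: "A \<in> pattern_mats G" "has_snt_factorization A k"
    and lower: "\<And>M l. M \<in> pattern_mats G \<Longrightarrow> has_snt_factorization M l \<Longrightarrow> k \<le> l"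
  shows "st_plus_graph G = k"
proof -
  have ge: "k \<le> st_plus M" if "M \<in> pattern_mats G" for M
    using that lower st_plus_attained by (auto simp: pattern_mats_def)
  have "st_plus A \<le> k"
    unfolding st_plus_def using attained(2) by (rule Least_le)
  then have "st_plus A = k" using ge[OF attained(1)] by simp
  then show ?thesis
    unfolding st_plus_graph_def using attained(1) ge by (intro Least_equality) auto
qed

lemma sym_nonneg_mats_entry_commute:
  assumes "A \<in> sym_nonneg_mats n" "i < n" "j < n"
  shows "A $$ (j, i) = A $$ (i, j)"
proof -
  have dim: "dim_row A = n" "dim_col A = n" and sym: "transpose_mat A = A"
    using assms(1) unfolding sym_nonneg_mats_def by blast+
  show ?thesis
    using index_transpose_mat(1)[of i A j] assms(2,3) unfolding sym dim by simp
qed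

lemma pattern_mats_entry_pos_iff:
  assumes "A \<in> pattern_mats G" "i < card (fst G)" "j < card (fst G)"
  shows "0 < A $$ (i, j) \<longleftrightarrow> {i, j} \<in> snd G"
proof -
  have dim: "dim_row A = card (fst G)" "dim_col A = card (fst G)"
    and G: "pattern_graph A = G"
    using assms(1) unfolding pattern_mats_def sym_nonneg_mats_def by blast+
  have swap: "A $$ (j, i) = A $$ (i, j)"
    using assms sym_nonneg_mats_entry_commute unfolding pattern_mats_def by blast
  have "{i, j} \<in> snd (pattern_graph A) \<longleftrightarrow> 0 < A $$ (i, j)"
  proof
    assume "{i, j} \<in> snd (pattern_graph A)"
    then obtain i' j' where "{i, j} = {i', j'}" and pos: "0 < A $$ (i', j')"
      unfolding pattern_graph_def snd_conv by blast
    then have "i' = i \<and> j' = j \<or> i' = j \<and> j' = i"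
      by (auto simp only: doubleton_eq_iff)
    then show "0 < A $$ (i, j)"
      using pos swap by metis
  next
    assume "0 < A $$ (i, j)"
    then show "{i, j} \<in> snd (pattern_graph A)"
      using assms(2,3) unfolding pattern_graph_def snd_conv dim by blast
  qed
  then show ?thesis unfolding G by blast
qed

lemma cycle_graph_edge_iff:
  assumes "i < n" "j < n"
  shows "{i, j} \<in> snd (cycle_graph n) \<longleftrightarrow> j = Suc i mod n \<or> i = Suc j mod n"
  using assms by (auto simp: cycle_graph_def doubleton_eq_iff)

lemma pattern_mats_cycle_graph_entry_pos_iff:
  assumes "A \<in> pattern_mats (cycle_graph n)" "i < n" "j < n"
  shows "0 < A $$ (i, j) \<longleftrightarrow> j = Suc i mod n \<or> i = Suc j mod n"
proof -
  have "card (fst (cycle_graph n)) = n" by (simp add: cycle_graph_def)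
  then show ?thesis
    using pattern_mats_entry_pos_iff[OF assms(1)] cycle_graph_edge_iff assms(2,3) by simp
qed

lemma pattern_mats_cycle_graph_sym:
  assumes "A \<in> pattern_mats (cycle_graph n)"
  shows "A \<in> sym_nonneg_mats n"
  using assms by (simp add: pattern_mats_def cycle_graph_def)

text \<open>Stepping forward twice from \<open>i\<close> to \<open>j\<close> and twice from \<open>j\<close> to \<open>i\<close> goes round the cycle
  in four steps, so only the cycle of length 4 admits crossed positive entries.\<close>

lemma cycle_successors_uncrossed:
  fixes n i j :: nat
  assumes n: "3 \<le> n" "n \<noteq> 4" and ij: "i < n" "j < n"
    and ij': "Suc j mod n = Suc i mod n \<or> i = Suc (Suc j mod n) mod n"
    and ji': "Suc i mod n = Suc j mod n \<or> j = Suc (Suc i mod n) mod n"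
  shows "i = j"
proof (cases "Suc i mod n = Suc j mod n")
  case True
  moreover have "Suc l mod n = (if Suc l = n then 0 else Suc l)" if "l < n" for l
    using that by simp
  ultimately show ?thesis using ij by (simp split: if_splits)
next
  case False
  have i: "(j + 2) mod n = i" and j: "(i + 2) mod n = j"
    using False ij' ji' unfolding mod_Suc_eq add_2_eq_Suc' by auto
  have "(i + 4) mod n = ((i + 2) mod n + 2) mod n"
    using mod_add_left_eq[of "i + 2" n 2] by (simp only: add.assoc numeral_plus_numeral add_num_simps)
  then have "(i + 4) mod n = i mod n"
    unfolding i j using ij(1) by simp
  then have "n dvd (i + 4) - i"
    using mod_eq_dvd_iff_nat[of i "i + 4" n] by simp
  then have "n dvd 4" by simp
  then have "n \<le> 4" by (rule dvd_imp_le) simp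
  with n have "n = 3" by simp
  with \<open>n dvd 4\<close> show ?thesis by simp
qed

lemma cycle_graph_factorization_ge:
  assumes n: "3 \<le> n" "n \<noteq> 4"
    and A: "A \<in> pattern_mats (cycle_graph n)" and fac: "has_snt_factorization A k"
  shows "n \<le> k"
proof -
  have succ: "Suc i mod n < n" for i using n by simp
  have "card {..<n} \<le> k"
  proof (rule fooling_set_bound[OF _ fac, where s = "\<lambda>i. Suc i mod n"])
    show "A \<in> carrier_mat n n"
      using pattern_mats_cycle_graph_sym[OF A] by (simp add: sym_nonneg_mats_def)
    show "0 < A $$ (i, Suc i mod n)" if "i \<in> {..<n}" for i
      using that succ by (simp add: pattern_mats_cycle_graph_entry_pos_iff[OF A])
    show "i = j"
      if "i \<in> {..<n}" "j \<in> {..<n}" "0 < A $$ (i, Suc j mod n)" "0 < A $$ (j, Suc i mod n)" for i j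
      using that succ
      by (intro cycle_successors_uncrossed[OF n])
        (simp_all add: pattern_mats_cycle_graph_entry_pos_iff[OF A])
  qed (use succ in auto)
  then show ?thesis by simp
qed

lemma loopless_edge_factorization_ge_2:
  assumes A: "A \<in> sym_nonneg_mats n" and fac: "has_snt_factorization A k"
    and ij: "i < n" "j < n" "0 < A $$ (i, j)" and diag: "A $$ (i, i) = 0" "A $$ (j, j) = 0"
  shows "2 \<le> k"
proof -
  have "A $$ (j, i) = A $$ (i, j)"
    using A ij by (intro sym_nonneg_mats_entry_commute)
  moreover have "i \<noteq> j" using ij diag by auto
  \<comment> \<open>The two entries of the edge have the two diagonal entries as their crossed entries.\<close>
  moreover have "card {i, j} \<le> k"
    by (rule fooling_set_bound[OF _ fac, where n = n and s = "\<lambda>v. if v = i then j else i"])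
      (use A ij diag calculation in \<open>auto simp: sym_nonneg_mats_def\<close>)
  ultimately show ?thesis by simp
qed

lemma st_plus_graph_cycle_4: "st_plus_graph (cycle_graph 4) = 2"
proof -
  define A :: "real mat" where "A = mat 4 4 (\<lambda>(i, j). if even (i + j) then 0 else 1)"
  \<comment> \<open>The rows of \<open>B\<close> assign each vertex to its parity class, and \<open>C\<close> joins the two classes.\<close>
  define B :: "real mat" where "B = mat 4 2 (\<lambda>(i, p). if i mod 2 = p then 1 else 0)"
  define C :: "real mat" where "C = mat 2 2 (\<lambda>(p, q). if p = q then 0 else 1)"
  have less_4: "i < 4 \<longleftrightarrow> i = 0 \<or> i = 1 \<or> i = 2 \<or> i = 3" for i :: nat by auto
  have dim: "dim_row A = 4" by (simp add: A_def)
  have A_sym: "A \<in> sym_nonneg_mats 4"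
    by (auto simp: A_def sym_nonneg_mats_def nonneg_mat_def add.commute)
  have edge: "0 < A $$ (i, j) \<longleftrightarrow> {i, j} \<in> snd (cycle_graph 4)" if "i < 4" "j < 4" for i j
  proof -
    have "0 < A $$ (i, j) \<longleftrightarrow> odd (i + j)"
      using that by (simp add: A_def)
    also have "\<dots> \<longleftrightarrow> j = Suc i mod 4 \<or> i = Suc j mod 4"
      using that unfolding less_4 by (elim disjE) simp_all
    finally show ?thesis
      unfolding cycle_graph_edge_iff[OF that] .
  qed
  have "pattern_graph A = cycle_graph 4"
  proof -
    have "snd (pattern_graph A) = {{i, j} | i j. i < 4 \<and> j < 4 \<and> {i, j} \<in> snd (cycle_graph 4)}"
      using edge by (auto simp: pattern_graph_def dim)
    also have "\<dots> = snd (cycle_graph 4)"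
      by (force simp: cycle_graph_def)
    finally show ?thesis
      by (simp add: pattern_graph_def cycle_graph_def A_def)
  qed
  then have A_pattern: "A \<in> pattern_mats (cycle_graph 4)"
    using A_sym by (simp add: pattern_mats_def cycle_graph_def)
  have classes: "{0..<2} = {0, 1 :: nat}" by auto
  have "A = B * C * transpose_mat B"
  proof (rule eq_matI)
    fix i j assume "i < dim_row (B * C * transpose_mat B)" "j < dim_col (B * C * transpose_mat B)"
    then have "i < 4" "j < 4" by (simp_all add: B_def)
    then show "A $$ (i, j) = (B * C * transpose_mat B) $$ (i, j)"
      unfolding less_4 by (auto simp: A_def B_def C_def scalar_prod_def classes)
  qed (simp_all add: A_def B_def)
  moreover have "C \<in> sym_nonneg_mats 2"
    by (auto simp: C_def sym_nonneg_mats_def nonneg_mat_def)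
  moreover have "B \<in> carrier_mat (dim_row A) 2" "nonneg_mat B"
    by (auto simp: A_def B_def nonneg_mat_def)
  ultimately have A_fac: "has_snt_factorization A 2"
    unfolding has_snt_factorization_def by blast
  have "2 \<le> l" if M: "M \<in> pattern_mats (cycle_graph 4)" and "has_snt_factorization M l" for M l
  proof (rule loopless_edge_factorization_ge_2[of M 4 l 0 1])
    show M_sym: "M \<in> sym_nonneg_mats 4" by (rule pattern_mats_cycle_graph_sym[OF M])
    have "0 \<le> M $$ (v, v)" if "v < 4" for v
      using M_sym that by (auto simp: sym_nonneg_mats_def nonneg_mat_def)
    moreover have "\<not> 0 < M $$ (v, v)" if "v < 4" for v
      using that unfolding pattern_mats_cycle_graph_entry_pos_iff[OF M that that] less_4 by auto
    ultimately have "M $$ (v, v) = 0" if "v < 4" for v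
      using that by (simp add: less_le)
    then show "M $$ (0, 0) = 0" "M $$ (1, 1) = 0" by simp_all
  qed (use that in \<open>simp_all add: pattern_mats_cycle_graph_entry_pos_iff[OF M]\<close>)
  then show ?thesis
    using A_pattern A_fac by (intro st_plus_graph_eqI)
qed

theorem proposition3p10:
  shows "(\<forall>n::nat. n \<ge> 3 \<and> n \<noteq> 4 \<longrightarrow> st_plus_graph (cycle_graph n) = n)
    \<and> st_plus_graph (cycle_graph 4) = 2"
proof (intro conjI allI impI)
  fix n :: nat assume n: "n \<ge> 3 \<and> n \<noteq> 4"
  obtain A where A: "A \<in> pattern_mats (cycle_graph n)"
    using pattern_mats_cycle_graph_nonempty by blast
  have "has_snt_factorization A n"
    using pattern_mats_cycle_graph_sym[OF A] by (rule has_snt_factorization_dim)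
  then show "st_plus_graph (cycle_graph n) = n"
    using A n cycle_graph_factorization_ge by (intro st_plus_graph_eqI) auto
qed (rule st_plus_graph_cycle_4)

end
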